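(* Let $H$ and $H'$ be irreducible unitary, projective, positive energy representations of the Witt superalgebra $\mathfrak W_{1/2}$, with associated parameters $(c,h)$ and $(c',h')$. If $c=c'$ and $h=h'$, then $H$ and $H'$ are unitarily equivalent as $\mathfrak W_{1/2}$-modules.
   Context: $\mathfrak W_{1/2}$ is the complex Lie superalgebra with even part $\bigoplus_{n\in\mathbb Z}\mathbb C d_n$, odd part $\bigoplus_{m\in\mathbb Z+1/2}\mathbb C\gamma_m$, brackets $[d_m,d_n]=(m-n)d_{m+n}$, $[\gamma_m,d_n]=(m-\frac n2)\gamma_{m+n}$, $[\gamma_m,\gamma_n]_+=2d_{m+n}$, and $\star$-structure $d_n^\star=d_{-n}$, $\gamma_m^\star=\gamma_{-m}$. Let $H$ be a prehilbert space and $\pi:\mathfrak W_{1/2}\to \mathrm{End}(H)$. The representation is: unitary if $\pi(A)^\star=\pi(A^\star)$; projective if $\pi$ is linear and $[\pi(A),\pi(B)]-\pi([A,B])\in\mathbb C\cdot I$ for homogeneous $A,B$ (graded bracket); positive energy if $H$ has an orthogonal decomposition $H=\bigoplus_{n\in\frac12\mathbb N}H_n$ and there is $D$ acting on $H_n$ as multiplication by $n$, with $H_0\neq\{0\}$, $\dim H_n<\infty$, and $D=\pi(d_0)-hI$ for some $h\in\mathbb C$. Normalization: replacing $\pi(A)$ by $\pi(A)+f(A)I$ for a suitable $\star$-linear form $f$, the operators $L_n=\pi(d_n)$, $G_m=\pi(\gamma_m)$ satisfy $[L_m,L_n]=(m-n)L_{m+n}+\frac c{12}(m^3-m)\delta_{m+n,0}I$,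 $[G_m,L_n]=(m-\frac n2)G_{m+n}$, $[G_m,G_n]_+=2L_{m+n}+\frac c3(m^2-\frac14)\delta_{m+n,0}I$ for a scalar $c$ (the central charge). Representations are always taken with this normalization; then $h$ is defined by $D=L_0-hI$, i.e. $h$ is the eigenvalue of $L_0$ on $H_0$. *)

theory Defs
  imports Complex_Main "HOL-Library.Poly_Mapping"
begin

section \<open>Complex prehilbert spaces\<close>

text \<open>The inner product is antilinear in its first and linear in its second argument.
  No completeness is assumed.\<close>

class prehilbert = ab_group_add +
  fixes scaleC :: "complex \<Rightarrow> 'a \<Rightarrow> 'a" (infixr \<open>*\<^sub>C\<close> 75)
    and cinner :: "'a \<Rightarrow> 'a \<Rightarrow> complex"
  assumes scaleC_add_right: "a *\<^sub>C (x + y) = a *\<^sub>C x + a *\<^sub>C y"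
    and scaleC_add_left: "(a + b) *\<^sub>C x = a *\<^sub>C x + b *\<^sub>C x"
    and scaleC_scaleC: "a *\<^sub>C (b *\<^sub>C x) = (a * b) *\<^sub>C x"
    and scaleC_one: "1 *\<^sub>C x = x"
    and cinner_commute: "cinner x y = cnj (cinner y x)"
    and cinner_add_right: "cinner x (y + z) = cinner x y + cinner x z"
    and cinner_scaleC_right: "cinner x (a *\<^sub>C y) = a * cinner x y"
    and cinner_ge_zero: "0 \<le> Re (cinner x x)"
    and cinner_eq_zero_iff: "cinner x x = 0 \<longleftrightarrow> x = 0"

global_interpretation cvec: vector_space "scaleC :: complex \<Rightarrow> 'a::prehilbert \<Rightarrow> 'a"
  by unfold_locales (simp_all add: scaleC_add_right scaleC_add_left scaleC_scaleC scaleC_one)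

abbreviation clinear :: "('a::prehilbert \<Rightarrow> 'b::prehilbert) \<Rightarrow> bool" where
  "clinear \<equiv> Vector_Spaces.linear scaleC scaleC"


section \<open>The Witt superalgebra\<close>

text \<open>\<open>Dn n\<close> stands for the basis vector \<open>d\<^sub>n\<close>, and \<open>Gm k\<close> for the
  basis vector \<open>\<gamma>\<^sub>m\<close> with \<open>m = k + 1/2\<close>.\<close>

datatype witt_basis = Dn int | Gm int

type_synonym witt = "witt_basis \<Rightarrow>\<^sub>0 complex"

definition half :: "int \<Rightarrow> complex" where
  "half k = of_int k + 1 / 2"

definition d :: "int \<Rightarrow> witt" where
  "d n = Poly_Mapping.single (Dn n) 1"

definition \<gamma> :: "int \<Rightarrow> witt" where
  "\<gamma> k = Poly_Mapping.single (Gm k) 1"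

definition witt_scale :: "complex \<Rightarrow> witt \<Rightarrow> witt" where
  "witt_scale a A = Poly_Mapping.map (\<lambda>x. a * x) A"

text \<open>The parity \<open>p \<in> {0, 1}\<close> selects the even or the odd part.\<close>

definition witt_part :: "nat \<Rightarrow> witt set" where
  "witt_part p = {A. Poly_Mapping.keys A \<subseteq> (if p = 0 then range Dn else range Gm)}"

text \<open>The bracket on the basis; the sum of the indices \<open>j + 1/2\<close> and \<open>k + 1/2\<close> is the
  integer \<open>j + k + 1\<close>, and \<open>[d\<^sub>n, \<gamma>\<^sub>m] = - [\<gamma>\<^sub>m, d\<^sub>n]\<close> by
  graded antisymmetry.\<close>

fun basis_bracket :: "witt_basis \<Rightarrow> witt_basis \<Rightarrow> witt" where
  "basis_bracket (Dn m) (Dn n) = witt_scale (of_int (m - n)) (d (m + n))"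
| "basis_bracket (Gm k) (Dn n) = witt_scale (half k - of_int n / 2) (\<gamma> (k + n))"
| "basis_bracket (Dn n) (Gm k) = witt_scale (- (half k - of_int n / 2)) (\<gamma> (k + n))"
| "basis_bracket (Gm j) (Gm k) = witt_scale 2 (d (j + k + 1))"

definition witt_bracket :: "witt \<Rightarrow> witt \<Rightarrow> witt" where
  "witt_bracket A B =
     (\<Sum>i\<in>Poly_Mapping.keys A. \<Sum>j\<in>Poly_Mapping.keys B.
        witt_scale (Poly_Mapping.lookup A i * Poly_Mapping.lookup B j) (basis_bracket i j))"

text \<open>\<open>- (k + 1/2) = (- k - 1) + 1/2\<close>\<close>

fun basis_star :: "witt_basis \<Rightarrow> witt" where
  "basis_star (Dn n) = d (- n)"
| "basis_star (Gm k) = \<gamma> (- k - 1)"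

definition witt_star :: "witt \<Rightarrow> witt" where
  "witt_star A =
     (\<Sum>i\<in>Poly_Mapping.keys A. witt_scale (cnj (Poly_Mapping.lookup A i)) (basis_star i))"

lemma witt_scale_one [simp]: "witt_scale 1 A = A"
  by (rule poly_mapping_eqI) (simp add: witt_scale_def Poly_Mapping.map.rep_eq when_def)

lemma witt_bracket_basis:
  "witt_bracket (d m) (d n) = witt_scale (of_int (m - n)) (d (m + n))"
  "witt_bracket (\<gamma> k) (d n) = witt_scale (half k - of_int n / 2) (\<gamma> (k + n))"
  "witt_bracket (d n) (\<gamma> k) = witt_scale (- (half k - of_int n / 2)) (\<gamma> (k + n))"
  "witt_bracket (\<gamma> j) (\<gamma> k) = witt_scale 2 (d (j + k + 1))"
  by (simp_all add: witt_bracket_def d_def \<gamma>_def)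

lemma witt_star_basis:
  "witt_star (d n) = d (- n)"
  "witt_star (\<gamma> k) = \<gamma> (- k - 1)"
  by (simp_all add: witt_star_def d_def \<gamma>_def)


section \<open>Representations\<close>

definition graded_commutator ::
    "nat \<Rightarrow> nat \<Rightarrow> ('a \<Rightarrow> 'a) \<Rightarrow> ('a \<Rightarrow> 'a) \<Rightarrow> 'a \<Rightarrow> 'a::prehilbert" where
  "graded_commutator p q S T x = S (T x) - ((- 1) ^ (p * q)) *\<^sub>C T (S x)"

definition projective_rep :: "(witt \<Rightarrow> 'a \<Rightarrow> 'a::prehilbert) \<Rightarrow> bool" where
  "projective_rep \<pi> \<longleftrightarrow>
     (\<forall>A. clinear (\<pi> A)) \<and>
     (\<forall>A B x. \<pi> (A + B) x = \<pi> A x + \<pi> B x) \<and>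
     (\<forall>a A x. \<pi> (witt_scale a A) x = a *\<^sub>C \<pi> A x) \<and>
     (\<forall>p\<in>{0, 1}. \<forall>q\<in>{0, 1}. \<forall>A\<in>witt_part p. \<forall>B\<in>witt_part q.
        \<exists>z. \<forall>x. graded_commutator p q (\<pi> A) (\<pi> B) x - \<pi> (witt_bracket A B) x = z *\<^sub>C x)"

definition unitary_rep :: "(witt \<Rightarrow> 'a \<Rightarrow> 'a::prehilbert) \<Rightarrow> bool" where
  "unitary_rep \<pi> \<longleftrightarrow>
     (\<forall>A x y. cinner (\<pi> A x) y = cinner x (\<pi> (witt_star A) y))"

text \<open>\<open>E k\<close> is the energy space \<open>H\<^sub>n\<close> with \<open>n = k/2\<close>. Pairwise orthogonality and
  positive definiteness make the sum of the energy spaces direct.\<close>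

definition positive_energy_rep :: "(witt \<Rightarrow> 'a \<Rightarrow> 'a::prehilbert) \<Rightarrow> complex \<Rightarrow> bool" where
  "positive_energy_rep \<pi> h \<longleftrightarrow>
     (\<exists>(E :: nat \<Rightarrow> 'a set) (D :: 'a \<Rightarrow> 'a).
        (\<forall>k. cvec.subspace (E k)) \<and>
        (\<forall>j k. j \<noteq> k \<longrightarrow> (\<forall>x\<in>E j. \<forall>y\<in>E k. cinner x y = 0)) \<and>
        cvec.span (\<Union>k. E k) = UNIV \<and>
        clinear D \<and>
        (\<forall>k. \<forall>x\<in>E k. D x = (of_nat k / 2) *\<^sub>C x) \<and>
        E 0 \<noteq> {0} \<and>
        (\<forall>k. \<exists>B. finite B \<and> cvec.span B = E k) \<and>
        (\<forall>x. D x = \<pi> (d 0) x - h *\<^sub>C x))"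

text \<open>The choice of the additive constants in \<open>\<pi>\<close>, with central charge \<open>c\<close>.\<close>

definition normalized_rep :: "(witt \<Rightarrow> 'a \<Rightarrow> 'a::prehilbert) \<Rightarrow> complex \<Rightarrow> bool" where
  "normalized_rep \<pi> c \<longleftrightarrow>
     (let L = \<lambda>n. \<pi> (d n); G = \<lambda>k. \<pi> (\<gamma> k) in
       (\<forall>m n x. L m (L n x) - L n (L m x) =
          of_int (m - n) *\<^sub>C L (m + n) x
          + (if m + n = 0 then c / 12 * (of_int m ^ 3 - of_int m) else 0) *\<^sub>C x) \<and>
       (\<forall>k n x. G k (L n x) - L n (G k x) =
          (half k - of_int n / 2) *\<^sub>C G (k + n) x) \<and>
       (\<forall>j k x. G j (G k x) + G k (G j x) =
          2 *\<^sub>C L (j + k + 1) x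
          + (if j + k + 1 = 0 then c / 3 * (half j ^ 2 - 1 / 4) else 0) *\<^sub>C x))"

definition irreducible_rep :: "(witt \<Rightarrow> 'a \<Rightarrow> 'a::prehilbert) \<Rightarrow> bool" where
  "irreducible_rep \<pi> \<longleftrightarrow>
     (\<exists>x :: 'a. x \<noteq> 0) \<and>
     (\<forall>V. cvec.subspace V \<and> (\<forall>A. \<forall>x\<in>V. \<pi> A x \<in> V) \<longrightarrow> V = {0} \<or> V = UNIV)"

definition unitarily_equivalent ::
    "(witt \<Rightarrow> 'a \<Rightarrow> 'a::prehilbert) \<Rightarrow> (witt \<Rightarrow> 'b \<Rightarrow> 'b::prehilbert) \<Rightarrow> bool" where
  "unitarily_equivalent \<pi> \<pi>' \<longleftrightarrow>
     (\<exists>U :: 'a \<Rightarrow> 'b. clinear U \<and> bij U \<and>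
        (\<forall>x y. cinner (U x) (U y) = cinner x y) \<and>
        (\<forall>A x. U (\<pi> A x) = \<pi>' A (U x)))"

end

theory Submission
  imports Defs
begin

text \<open>A unit vector \<open>\<Omega>\<close> of lowest energy is an eigenvector of \<open>L\<^sub>0\<close> killed by all operators of
  positive index, and by irreducibility the words in the generators applied to \<open>\<Omega>\<close> span \<open>H\<close>.
  By unitarity the Gram matrix of these vectors consists of vacuum expectations
  \<open>\<langle>\<Omega>, \<pi>(b\<^sub>1) \<cdots> \<pi>(b\<^sub>n) \<Omega>\<rangle>\<close>. If \<open>b\<^sub>1\<close> has negative index the expectation vanishes, if it
  is \<open>d\<^sub>0\<close> a factor splits off, and otherwise \<open>\<pi>(b\<^sub>1)\<close> is commuted to the right until it kills
  \<open>\<Omega>\<close>, at the cost of shorter words. So the Gram matrix depends on \<open>c\<close> and \<open>h\<close> only, and two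
  spanning families with equal Gram matrices are related by a unitary map.\<close>

section \<open>Prehilbert spaces\<close>

lemma cinner_add_left: "cinner (x + y) z = cinner x z + cinner y (z :: 'a::prehilbert)"
  by (metis cinner_add_right cinner_commute complex_cnj_add)

lemma cinner_scaleC_left: "cinner (a *\<^sub>C x) y = cnj a * cinner x (y :: 'a::prehilbert)"
  by (metis cinner_commute cinner_scaleC_right complex_cnj_mult)

lemma cinner_zero_right [simp]: "cinner x 0 = (0 :: complex)" for x :: "'a::prehilbert"
  using cinner_add_right[of x 0 0] by simp

lemma cinner_zero_left [simp]: "cinner 0 x = (0 :: complex)" for x :: "'a::prehilbert"
  using cinner_add_left[of 0 0 x] by simp

lemma cinner_diff_right: "cinner x (y - z) = cinner x y - cinner x (z :: 'a::prehilbert)"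
  using cinner_add_right[of x "y - z" z] by simp

text \<open>The vectors orthogonal to \<open>y\<close> form a subspace, so \<open>y\<close> is
  orthogonal to itself and definiteness applies.\<close>

lemma orthogonal_to_spanning_set:
  fixes y :: "'a::prehilbert"
  assumes "cvec.span S = UNIV" and "\<And>x. x \<in> S \<Longrightarrow> cinner x y = 0"
  shows "y = 0"
proof -
  have "cinner x y = 0" for x
  proof -
    have "x \<in> cvec.span S"
      using assms(1) by simp
    then show ?thesis
      by (induction rule: cvec.span_induct_alt)
        (simp_all add: cinner_add_left cinner_scaleC_left assms(2))
  qed
  then show ?thesis
    using cinner_eq_zero_iff by blast
qed

lemma exists_unit_multiple:
  fixes x :: "'a::prehilbert"
  assumes "x \<noteq> 0"
  obtains a where "cinner (a *\<^sub>C x) (a *\<^sub>C x) = 1"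
proof
  define r where "r = Re (cinner x x)"
  have r: "cinner x x = of_real r"
    using cinner_commute[of x x] by (simp add: r_def complex_eq_iff)
  have "r \<noteq> 0"
    using assms cinner_eq_zero_iff[of x] r by auto
  then have "r > 0"
    using cinner_ge_zero[of x] by (simp add: r_def)
  then have "inverse (sqrt r) * (inverse (sqrt r) * r) = 1"
    by (simp add: field_simps)
  then show "cinner (of_real (inverse (sqrt r)) *\<^sub>C x) (of_real (inverse (sqrt r)) *\<^sub>C x) = 1"
    unfolding cinner_scaleC_left cinner_scaleC_right r complex_cnj_complex_of_real
    by (metis of_real_1 of_real_mult)
qed

text \<open>The families may be linearly dependent, so \<open>U\<close> is not built by linear
  extension: \<open>U x\<close> is the vector whose products with all \<open>g i\<close> equal those
  of \<open>x\<close> with \<open>f i\<close>. It exists because \<open>f\<close> spans and is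
  unique because \<open>g\<close> spans; linearity follows from uniqueness.\<close>

lemma exists_isometry_of_equal_gram:
  fixes f :: "'i \<Rightarrow> 'a::prehilbert" and g :: "'i \<Rightarrow> 'b::prehilbert"
  assumes f: "cvec.span (range f) = UNIV" and g: "cvec.span (range g) = UNIV"
    and fg: "\<And>i j. cinner (f i) (f j) = cinner (g i) (g j)"
  obtains U where "clinear U" "bij U" "\<And>x y. cinner (U x) (U y) = cinner x y"
    "\<And>i. U (f i) = g i"
proof -
  have ex: "\<exists>y. \<forall>i. cinner (g i) y = cinner (f i) x" for x
  proof -
    have "x \<in> cvec.span (range f)"
      using f by simp
    then show ?thesis
    proof (induction rule: cvec.span_induct_alt)
      case base
      show ?case
        by (rule exI[of _ 0]) simp
    next
      case (step a v z)
      then obtain j y where "v = f j" "\<forall>i. cinner (g i) y = cinner (f i) z"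
        by blast
      then show ?case
        by (intro exI[of _ "a *\<^sub>C g j + y"]) (simp add: cinner_add_right cinner_scaleC_right fg)
    qed
  qed
  then obtain U where U: "\<And>x i. cinner (g i) (U x) = cinner (f i) x"
    by metis
  have uniq: "y = z" if "\<And>i. cinner (g i) y = cinner (g i) z" for y z
    using orthogonal_to_spanning_set[OF g, of "y - z"] that by (auto simp: cinner_diff_right)
  have Uadd: "U (x + y) = U x + U y" and Uscale: "U (a *\<^sub>C x) = a *\<^sub>C U x" for x y a
    by (rule uniq; simp add: U cinner_add_right cinner_scaleC_right)+
  have Uf: "U (f i) = g i" for i
    by (rule uniq) (simp add: U fg)
  have lin: "clinear U"
    by unfold_locales (simp_all add: Uadd Uscale)
  have U0: "U 0 = 0"
    by (rule uniq) (simp add: U)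
  have iso: "cinner (U x) (U y) = cinner x y" for x y
  proof -
    have "x \<in> cvec.span (range f)"
      using f by simp
    then show ?thesis
      by (induction rule: cvec.span_induct_alt)
        (auto simp: U0 Uadd Uscale cinner_add_left cinner_scaleC_left U Uf)
  qed
  have "inj U"
  proof (rule injI)
    fix x y
    assume "U x = U y"
    then have "U (x - y) = 0"
      using Uadd[of "x - y" y] by simp
    then have "cinner (x - y) (x - y) = 0"
      using iso[of "x - y" "x - y"] by simp
    then have "x - y = 0"
      by (simp only: cinner_eq_zero_iff)
    then show "x = y"
      by simp
  qed
  moreover have "surj U"
  proof -
    have "y \<in> range U" for y
    proof -
      have "y \<in> cvec.span (range g)"
        using g by simp
      then show ?thesis
      proof (induction rule: cvec.span_induct_alt)
        case base
        show ?case
          by (rule range_eqI[of _ _ 0]) (simp add: U0)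
      next
        case (step a v z)
        then obtain j x where "v = g j" "z = U x"
          by blast
        then show ?case
          by (intro range_eqI[of _ _ "a *\<^sub>C f j + x"]) (simp add: Uadd Uscale Uf)
      qed
    qed
    then show ?thesis
      by blast
  qed
  ultimately show ?thesis
    using that[OF lin _ iso Uf] by (simp add: bij_def)
qed

section \<open>Basis vectors of the Witt superalgebra\<close>

abbreviation basis_vector :: "witt_basis \<Rightarrow> witt" where
  "basis_vector b \<equiv> Poly_Mapping.single b 1"

text \<open>The amount by which a basis vector lowers eigenvalues of \<open>\<pi> (d 0)\<close>. It
  is real so that signs can be compared, whereas \<open>half\<close> is complex.\<close>

fun mode :: "witt_basis \<Rightarrow> real" where
  "mode (Dn n) = of_int n"
| "mode (Gm k) = of_int k + 1 / 2"

text \<open>The star permutes the basis; expressed on labels, it makes the adjoint of a word a word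
  again.\<close>

fun basis_adjoint :: "witt_basis \<Rightarrow> witt_basis" where
  "basis_adjoint (Dn n) = Dn (- n)"
| "basis_adjoint (Gm k) = Gm (- k - 1)"

lemma mode_basis_adjoint [simp]: "mode (basis_adjoint b) = - mode b"
  by (cases b) simp_all

lemma mode_eq_zero_iff: "mode b = 0 \<longleftrightarrow> b = Dn 0"
proof (cases b)
  case (Gm k)
  \<comment> \<open>Doubling a half-integer index gives an odd integer, which cannot vanish.\<close>
  have "real_of_int (2 * k + 1) \<noteq> 0"
    unfolding of_int_eq_0_iff by presburger
  then show ?thesis
    using Gm by auto
qed simp

lemma witt_star_basis_vector: "witt_star (basis_vector b) = basis_vector (basis_adjoint b)"
  by (cases b) (simp_all add: witt_star_basis flip: d_def \<gamma>_def)

text \<open>Every element is a finite sum of multiples of basis vectors; this carries identities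
  linear in \<open>A\<close> from basis vectors to the whole algebra.\<close>

lemma witt_induct [case_names scale_basis add]:
  assumes "\<And>a b. P (witt_scale a (basis_vector b))"
    and "\<And>A B. P A \<Longrightarrow> P B \<Longrightarrow> P (A + B)"
  shows "P A"
proof -
  have "witt_scale a (basis_vector b) = Poly_Mapping.single b a" for a b
    by (rule poly_mapping_eqI)
      (simp add: witt_scale_def Poly_Mapping.map.rep_eq when_def lookup_single)
  with assms(1) have single: "P (Poly_Mapping.single b a)" for a b
    by metis
  then have "P 0"
    by (metis single_zero)
  then show ?thesis
  proof (induction A rule: update_induct)
    case (update A b a)
    \<comment> \<open>The key \<open>b\<close> is new to \<open>A\<close>, so the update overwrites
      no coefficient.\<close>
    have "Poly_Mapping.update b a A = A + Poly_Mapping.single b a"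
      by (rule poly_mapping_eqI)
        (use update(1) in \<open>auto simp: lookup_update lookup_add lookup_single in_keys_iff\<close>)
    then show ?case
      using assms(2) single update by metis
  qed
qed

section \<open>Words applied to a highest weight vector\<close>

definition word_op :: "(witt \<Rightarrow> 'a \<Rightarrow> 'a) \<Rightarrow> witt_basis list \<Rightarrow> 'a \<Rightarrow> 'a::prehilbert" where
  "word_op \<pi> w = foldr (\<lambda>b. \<pi> (basis_vector b)) w"

text \<open>The norm is fixed so that the empty word has the same expectation in both
  representations.\<close>

definition highest_weight_vector ::
    "(witt \<Rightarrow> 'a \<Rightarrow> 'a::prehilbert) \<Rightarrow> complex \<Rightarrow> 'a \<Rightarrow> bool" where
  "highest_weight_vector \<pi> h \<Omega> \<longleftrightarrow>
     cinner \<Omega> \<Omega> = 1 \<and> \<pi> (d 0) \<Omega> = h *\<^sub>C \<Omega> \<and>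
     (\<forall>b. mode b > 0 \<longrightarrow> \<pi> (basis_vector b) \<Omega> = 0)"

lemma word_op_Nil [simp]: "word_op \<pi> [] x = x"
  and word_op_Cons [simp]: "word_op \<pi> (b # w) x = \<pi> (basis_vector b) (word_op \<pi> w x)"
  and word_op_append [simp]: "word_op \<pi> (v @ w) x = word_op \<pi> v (word_op \<pi> w x)"
  by (simp_all add: word_op_def)

lemma projective_rep_linear:
  assumes "projective_rep \<pi>"
  shows "\<pi> A (x + y) = \<pi> A x + \<pi> A y" "\<pi> A (a *\<^sub>C x) = a *\<^sub>C \<pi> A x" "\<pi> A 0 = 0"
    "\<pi> (A + B) x = \<pi> A x + \<pi> B x" "\<pi> (witt_scale a A) x = a *\<^sub>C \<pi> A x"
proof -
  have "clinear (\<pi> A)"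
    using assms by (simp add: projective_rep_def)
  then interpret Vector_Spaces.linear scaleC scaleC "\<pi> A" .
  show "\<pi> A (x + y) = \<pi> A x + \<pi> A y" "\<pi> A (a *\<^sub>C x) = a *\<^sub>C \<pi> A x" "\<pi> A 0 = 0"
    by (simp_all add: add scale zero)
  show "\<pi> (A + B) x = \<pi> A x + \<pi> B x" "\<pi> (witt_scale a A) x = a *\<^sub>C \<pi> A x"
    using assms by (simp_all add: projective_rep_def)
qed

lemma word_op_linear:
  assumes "projective_rep \<pi>"
  shows "word_op \<pi> w (x + y) = word_op \<pi> w x + word_op \<pi> w y"
    and "word_op \<pi> w (a *\<^sub>C x) = a *\<^sub>C word_op \<pi> w x"
    and "word_op \<pi> w 0 = 0"
  by (induction w) (simp_all add: projective_rep_linear[OF assms])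

text \<open>Taking adjoints letter by letter reverses the word. This reduces inner products of two
  words to vacuum expectations.\<close>

lemma cinner_word_op:
  assumes "unitary_rep \<pi>"
  shows "cinner (word_op \<pi> v x) y = cinner x (word_op \<pi> (rev (map basis_adjoint v)) y)"
proof (induction v arbitrary: y)
  case (Cons b v)
  have "cinner (word_op \<pi> (b # v) x) y
      = cinner (word_op \<pi> v x) (\<pi> (basis_vector (basis_adjoint b)) y)"
    using assms by (simp add: unitary_rep_def witt_star_basis_vector)
  then show ?case
    by (simp add: Cons.IH)
qed simp

text \<open>The span is invariant under basis vectors, since prefixing a letter gives another word,
  and hence under the whole algebra by linearity. It contains \<open>x\<close>, so irreducibility
  leaves only the whole space.\<close>

lemma span_words:
  assumes "irreducible_rep \<pi>" and \<pi>: "projective_rep \<pi>" and "x \<noteq> 0"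
  shows "cvec.span (range (\<lambda>w. word_op \<pi> w x)) = UNIV"
proof -
  let ?V = "cvec.span (range (\<lambda>w. word_op \<pi> w x))"
  have basis: "\<pi> (basis_vector b) y \<in> ?V" if "y \<in> ?V" for b y
    using that
  proof (induction rule: cvec.span_induct_alt)
    case base
    show ?case
      by (simp add: projective_rep_linear[OF \<pi>] cvec.span_zero)
  next
    case (step a v z)
    then obtain w where "v = word_op \<pi> w x"
      by blast
    then have "\<pi> (basis_vector b) v = word_op \<pi> (b # w) x"
      by simp
    then have "\<pi> (basis_vector b) v \<in> ?V"
      by (metis cvec.span_base rangeI)
    with step show ?case
      by (simp add: projective_rep_linear[OF \<pi>] cvec.span_add cvec.span_scale)
  qed
  have "\<pi> A y \<in> ?V" if "y \<in> ?V" for A y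
    by (induction A rule: witt_induct)
      (simp_all add: projective_rep_linear[OF \<pi>] cvec.span_add cvec.span_scale basis that)
  then have "?V = {0} \<or> ?V = UNIV"
    using assms(1) unfolding irreducible_rep_def by (meson cvec.subspace_span)
  moreover have "x \<in> ?V"
    by (metis cvec.span_base rangeI word_op_Nil)
  ultimately show ?thesis
    using \<open>x \<noteq> 0\<close> by blast
qed

section \<open>Commutation relations\<close>

text \<open>No central term survives here, since \<open>m^3 - m\<close> vanishes at 0. Hence each
  letter shifts eigenvalues of \<open>\<pi> (d 0)\<close> down by its mode.\<close>

lemma d0_commute:
  assumes "normalized_rep \<pi> c"
  shows "\<pi> (d 0) (\<pi> (basis_vector b) x) =
    \<pi> (basis_vector b) (\<pi> (d 0) x) - of_real (mode b) *\<^sub>C \<pi> (basis_vector b) x"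
proof (cases b)
  case (Dn n)
  have "\<pi> (d n) (\<pi> (d 0) x) - \<pi> (d 0) (\<pi> (d n) x) = of_int n *\<^sub>C \<pi> (d n) x"
    using assms unfolding normalized_rep_def Let_def
    by (cases "n = 0") (fastforce dest: spec[of _ n])+
  then show ?thesis
    using Dn by (simp add: d_def algebra_simps)
next
  case (Gm k)
  have "\<pi> (\<gamma> k) (\<pi> (d 0) x) - \<pi> (d 0) (\<pi> (\<gamma> k) x) = half k *\<^sub>C \<pi> (\<gamma> k) x"
    using assms unfolding normalized_rep_def Let_def
    by (metis add.right_neutral diff_zero div_0 of_int_0)
  then show ?thesis
    using Gm by (simp add: \<gamma>_def half_def algebra_simps)
qed

text \<open>The factors \<open>1\<close> and the zero terms give all four relations the one shape that
  \<open>exchange_relation\<close> needs.\<close>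

lemma normalized_rep_exchange:
  assumes "normalized_rep \<pi> c"
  shows "\<pi> (d m) (\<pi> (d n) x) = 1 *\<^sub>C \<pi> (d n) (\<pi> (d m) x) + of_int (m - n) *\<^sub>C \<pi> (d (m + n)) x
        + (if m + n = 0 then c / 12 * (of_int m ^ 3 - of_int m) else 0) *\<^sub>C x" (is ?DD)
    and "\<pi> (\<gamma> k) (\<pi> (d n) x) = 1 *\<^sub>C \<pi> (d n) (\<pi> (\<gamma> k) x)
        + (half k - of_int n / 2) *\<^sub>C \<pi> (\<gamma> (k + n)) x + 0 *\<^sub>C x" (is ?GD)
    and "\<pi> (d n) (\<pi> (\<gamma> k) x) = 1 *\<^sub>C \<pi> (\<gamma> k) (\<pi> (d n) x)
        + (- (half k - of_int n / 2)) *\<^sub>C \<pi> (\<gamma> (k + n)) x + 0 *\<^sub>C x" (is ?DG)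
    and "\<pi> (\<gamma> j) (\<pi> (\<gamma> k) x) = (- 1) *\<^sub>C \<pi> (\<gamma> k) (\<pi> (\<gamma> j) x) + 2 *\<^sub>C \<pi> (d (j + k + 1)) x
        + (if j + k + 1 = 0 then c / 3 * (half j ^ 2 - 1 / 4) else 0) *\<^sub>C x" (is ?GG)
proof -
  note rels = assms[unfolded normalized_rep_def Let_def]
  have "\<pi> (d m) (\<pi> (d n) x) - \<pi> (d n) (\<pi> (d m) x) = of_int (m - n) *\<^sub>C \<pi> (d (m + n)) x
      + (if m + n = 0 then c / 12 * (of_int m ^ 3 - of_int m) else 0) *\<^sub>C x"
    using rels by blast
  then show ?DD
    unfolding diff_eq_eq by (simp only: scaleC_one add.assoc add.commute add.left_commute)
  have "\<pi> (\<gamma> k) (\<pi> (d n) x) - \<pi> (d n) (\<pi> (\<gamma> k) x) = (half k - of_int n / 2) *\<^sub>C \<pi> (\<gamma> (k + n)) x"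
    using rels by blast
  then have GD: "\<pi> (\<gamma> k) (\<pi> (d n) x) =
      \<pi> (d n) (\<pi> (\<gamma> k) x) + (half k - of_int n / 2) *\<^sub>C \<pi> (\<gamma> (k + n)) x"
    by (simp only: diff_eq_eq add.commute)
  show ?GD
    by (simp only: GD scaleC_one cvec.scale_zero_left add_0_right)
  show ?DG
    by (simp only: GD scaleC_one cvec.scale_zero_left cvec.scale_minus_left add_0_right add.assoc
        right_minus)
  have "\<pi> (\<gamma> j) (\<pi> (\<gamma> k) x) + \<pi> (\<gamma> k) (\<pi> (\<gamma> j) x) = 2 *\<^sub>C \<pi> (d (j + k + 1)) x
      + (if j + k + 1 = 0 then c / 3 * (half j ^ 2 - 1 / 4) else 0) *\<^sub>C x"
    using rels by blast
  then have "\<pi> (\<gamma> j) (\<pi> (\<gamma> k) x) = - \<pi> (\<gamma> k) (\<pi> (\<gamma> j) x) + (2 *\<^sub>C \<pi> (d (j + k + 1)) x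
      + (if j + k + 1 = 0 then c / 3 * (half j ^ 2 - 1 / 4) else 0) *\<^sub>C x)"
    by (metis add.commute add_diff_cancel_right' diff_conv_add_uminus)
  then show ?GG
    by (simp only: cvec.scale_minus_left scaleC_one add.assoc)
qed

text \<open>The scalars and the letter \<open>e\<close> depend only on \<open>a\<close>,
  \<open>b\<close> and \<open>c\<close>, so one choice serves both representations. The sign
  \<open>s\<close> is -1 exactly for two odd letters, so one formula covers commutators and
  anticommutators.\<close>

lemma exchange_relation:
  assumes "normalized_rep \<pi> c" and "normalized_rep \<pi>' c"
  obtains s \<alpha> e \<beta> where
    "\<And>x. \<pi> (basis_vector a) (\<pi> (basis_vector b) x) =
      s *\<^sub>C \<pi> (basis_vector b) (\<pi> (basis_vector a) x) + \<alpha> *\<^sub>C \<pi> (basis_vector e) x + \<beta> *\<^sub>C x"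
    "\<And>x. \<pi>' (basis_vector a) (\<pi>' (basis_vector b) x) =
      s *\<^sub>C \<pi>' (basis_vector b) (\<pi>' (basis_vector a) x) + \<alpha> *\<^sub>C \<pi>' (basis_vector e) x + \<beta> *\<^sub>C x"
proof -
  note rel = normalized_rep_exchange[OF assms(1), unfolded d_def \<gamma>_def]
    and rel' = normalized_rep_exchange[OF assms(2), unfolded d_def \<gamma>_def]
  show ?thesis
  proof (cases a; cases b)
    fix m n
    assume ab: "a = Dn m" "b = Dn n"
    show ?thesis
      by (rule that[unfolded ab, OF rel(1) rel'(1)])
  next
    fix m k
    assume ab: "a = Dn m" "b = Gm k"
    show ?thesis
      by (rule that[unfolded ab, OF rel(3) rel'(3)])
  next
    fix k n
    assume ab: "a = Gm k" "b = Dn n"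
    show ?thesis
      by (rule that[unfolded ab, OF rel(2) rel'(2)])
  next
    fix j k
    assume ab: "a = Gm j" "b = Gm k"
    show ?thesis
      by (rule that[unfolded ab, OF rel(4) rel'(4)])
  qed
qed

section \<open>Lowest energy vectors\<close>

text \<open>A unit vector in \<open>E 0\<close> works: a letter of positive mode would push its
  energy below the minimum.\<close>

lemma exists_highest_weight_vector:
  fixes \<pi> :: "witt \<Rightarrow> 'a \<Rightarrow> 'a::prehilbert"
  assumes u: "unitary_rep \<pi>" and lin: "projective_rep \<pi>"
    and "positive_energy_rep \<pi> h" and norm: "normalized_rep \<pi> c"
  obtains \<Omega> where "highest_weight_vector \<pi> h \<Omega>"
proof -
  obtain E D where E: "\<And>k. cvec.subspace (E k)" "cvec.span (\<Union>k. E k) = UNIV" "E 0 \<noteq> {0}"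
      and D: "\<And>k x. x \<in> E k \<Longrightarrow> D x = (of_nat k / 2) *\<^sub>C x" "\<And>x. D x = \<pi> (d 0) x - h *\<^sub>C x"
    using assms(3) unfolding positive_energy_rep_def by metis
  obtain \<Omega>0 where \<Omega>0: "\<Omega>0 \<in> E 0" "\<Omega>0 \<noteq> 0"
    using E(3) cvec.subspace_0[OF E(1)[of 0]] by auto
  obtain a where a: "cinner (a *\<^sub>C \<Omega>0) (a *\<^sub>C \<Omega>0) = 1"
    using exists_unit_multiple[OF \<Omega>0(2)] .
  define \<Omega> where "\<Omega> = a *\<^sub>C \<Omega>0"
  have L0: "\<pi> (d 0) x = (h + of_nat k / 2) *\<^sub>C x" if "x \<in> E k" for k x
    using D(1)[OF that] D(2)[of x] by (simp add: scaleC_add_left algebra_simps)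
  have "\<Omega> \<in> E 0"
    unfolding \<Omega>_def using \<Omega>0(1) cvec.subspace_scale[OF E(1)] by blast
  then have hw: "\<pi> (d 0) \<Omega> = h *\<^sub>C \<Omega>"
    using L0[of \<Omega> 0] by simp
  have sym: "cinner (\<pi> (d 0) x) y = cinner x (\<pi> (d 0) y)" for x y
    using u by (simp add: unitary_rep_def witt_star_basis)
  \<comment> \<open>Symmetry of \<open>\<pi> (d 0)\<close> forces \<open>h\<close> to be real. This
    matters below, where an eigenvalue leaves the antilinear slot.\<close>
  have "cnj h = h"
    using sym[of \<Omega> \<Omega>] a by (simp add: hw cinner_scaleC_left cinner_scaleC_right flip: \<Omega>_def)
  have kill: "\<pi> (basis_vector b) \<Omega> = 0" if b: "mode b > 0" for b
  proof -
    let ?y = "\<pi> (basis_vector b) \<Omega>"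
    have y: "\<pi> (d 0) ?y = (h - of_real (mode b)) *\<^sub>C ?y"
      by (simp add: d0_commute[OF norm] hw projective_rep_linear[OF lin] cvec.scale_left_diff_distrib)
    \<comment> \<open>Eigenvectors of the symmetric \<open>\<pi> (d 0)\<close> are orthogonal when
      their eigenvalues differ; here these are \<open>h + k / 2\<close> and
      \<open>h - mode b\<close>, whose difference is positive.\<close>
    have "cinner x ?y = 0" if "x \<in> (\<Union>k. E k)" for x
    proof -
      from that obtain k where "x \<in> E k"
        by blast
      then have "(h + of_nat k / 2) * cinner x ?y = (h - of_real (mode b)) * cinner x ?y"
        using sym[of x ?y] by (simp add: L0 y cinner_scaleC_left cinner_scaleC_right \<open>cnj h = h\<close>)
      then have "complex_of_real (real k / 2 + mode b) * cinner x ?y = 0"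
        by (simp add: algebra_simps)
      moreover have "real k / 2 + mode b > 0"
        using b by (simp add: add_nonneg_pos)
      ultimately show ?thesis
        by (metis less_irrefl mult_eq_0_iff of_real_eq_0_iff)
    qed
    then show ?thesis
      by (rule orthogonal_to_spanning_set[OF E(2)])
  qed
  show ?thesis
    using that[of \<Omega>] a hw kill by (simp add: highest_weight_vector_def \<Omega>_def)
qed

section \<open>Vacuum expectations\<close>

text \<open>Both representations undergo the same rewriting with the same scalars, so no expectation
  has to be computed explicitly.\<close>

lemma vacuum_expectation_unique:
  assumes \<pi>: "unitary_rep \<pi>" "projective_rep \<pi>" "normalized_rep \<pi> c" "highest_weight_vector \<pi> h \<Omega>"
    and \<pi>': "unitary_rep \<pi>'" "projective_rep \<pi>'" "normalized_rep \<pi>' c"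
      "highest_weight_vector \<pi>' h \<Omega>'"
  shows "cinner \<Omega> (word_op \<pi> w \<Omega>) = cinner \<Omega>' (word_op \<pi>' w \<Omega>')"
proof (induction w rule: length_induct)
  case (1 w)
  let ?agree = "\<lambda>w. cinner \<Omega> (word_op \<pi> w \<Omega>) = cinner \<Omega>' (word_op \<pi>' w \<Omega>')"
  have shorter: "?agree v" if "length v < length w" for v
    using 1 that by blast
  note lin = projective_rep_linear[OF \<pi>(2)] projective_rep_linear[OF \<pi>'(2)]
    word_op_linear[OF \<pi>(2)] word_op_linear[OF \<pi>'(2)] cinner_add_right cinner_scaleC_right
  have kill: "\<pi> (basis_vector b) \<Omega> = 0" "\<pi>' (basis_vector b) \<Omega>' = 0" if "mode b > 0" for b
    using \<pi>(4) \<pi>'(4) that by (simp_all add: highest_weight_vector_def)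
  have hw: "\<pi> (d 0) \<Omega> = h *\<^sub>C \<Omega>" "\<pi>' (d 0) \<Omega>' = h *\<^sub>C \<Omega>'"
    using \<pi>(4) \<pi>'(4) by (simp_all add: highest_weight_vector_def)
  have adj: "cinner x (\<pi> (basis_vector b) y) = cinner (\<pi> (basis_vector (basis_adjoint b)) x) y"
      "cinner x' (\<pi>' (basis_vector b) y') = cinner (\<pi>' (basis_vector (basis_adjoint b)) x') y'"
    for b x y x' y'
  proof -
    have "basis_adjoint (basis_adjoint b) = b"
      by (cases b) simp_all
    then show "cinner x (\<pi> (basis_vector b) y) = cinner (\<pi> (basis_vector (basis_adjoint b)) x) y"
      "cinner x' (\<pi>' (basis_vector b) y') = cinner (\<pi>' (basis_vector (basis_adjoint b)) x') y'"
      using \<pi>(1) \<pi>'(1) by (simp_all add: unitary_rep_def witt_star_basis_vector)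
  qed
  \<comment> \<open>Inner induction on the letters to the right of \<open>b\<close>, with the left
    context \<open>u\<close> arbitrary and the total length fixed.\<close>
  have positive: "?agree (u @ b # v)"
    if b: "mode b > 0" and "length (u @ b # v) = length w" for u b v
    using that(2)
  proof (induction v arbitrary: u)
    case Nil
    show ?case
      by (simp add: kill[OF b] lin)
  next
    case (Cons b' v)
    obtain s \<alpha> e \<beta> where ex:
      "\<And>x. \<pi> (basis_vector b) (\<pi> (basis_vector b') x) =
        s *\<^sub>C \<pi> (basis_vector b') (\<pi> (basis_vector b) x) + \<alpha> *\<^sub>C \<pi> (basis_vector e) x + \<beta> *\<^sub>C x"
      "\<And>x. \<pi>' (basis_vector b) (\<pi>' (basis_vector b') x) =
        s *\<^sub>C \<pi>' (basis_vector b') (\<pi>' (basis_vector b) x) + \<alpha> *\<^sub>C \<pi>' (basis_vector e) x + \<beta> *\<^sub>C x"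
      by (rule exchange_relation[OF \<pi>(3) \<pi>'(3), of b b']) (rule that)
    \<comment> \<open>The swapped word keeps its length and has one letter fewer after
      \<open>b\<close>. In the correction terms \<open>e\<close> replaces two letters and the scalar
      removes both, so the outer induction applies to them.\<close>
    have "?agree ((u @ [b']) @ b # v)"
      by (rule Cons.IH) (use Cons.prems in simp)
    moreover have "?agree (u @ e # v)" "?agree (u @ v)"
      by (rule shorter; use Cons.prems in simp)+
    ultimately show ?case
      by (simp add: ex lin)
  qed
  show ?case
  proof (cases w)
    case Nil
    then show ?thesis
      using \<pi>(4) \<pi>'(4) by (simp add: highest_weight_vector_def)
  next
    case (Cons b v)
    consider (pos) "mode b > 0" | (neg) "mode b < 0" | (zero) "b = Dn 0"
      using mode_eq_zero_iff[of b] by linarith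
    then show ?thesis
    proof cases
      case pos
      then show ?thesis
        using positive[of b "[]" v] Cons by simp
    next
      case neg
      \<comment> \<open>The adjoint letter has positive mode and kills the vacuum in the left
        slot.\<close>
      then show ?thesis
        using Cons by (simp add: adj kill)
    next
      case zero
      moreover have "?agree v"
        by (rule shorter) (simp add: Cons)
      \<comment> \<open>This letter is its own adjoint; moved to the left slot it contributes the
        factor \<open>cnj h\<close> in both representations.\<close>
      ultimately show ?thesis
        using Cons hw[unfolded d_def] by (simp add: adj cinner_scaleC_left)
    qed
  qed
qed

section \<open>The intertwining unitary\<close>

theorem theorem2p12:
  fixes \<pi> :: "witt \<Rightarrow> 'a \<Rightarrow> 'a::prehilbert"
    and \<pi>' :: "witt \<Rightarrow> 'b \<Rightarrow> 'b::prehilbert"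
    and c h c' h' :: complex
  assumes "irreducible_rep \<pi>" and "unitary_rep \<pi>" and "projective_rep \<pi>"
    and "positive_energy_rep \<pi> h" and "normalized_rep \<pi> c"
    and "irreducible_rep \<pi>'" and "unitary_rep \<pi>'" and "projective_rep \<pi>'"
    and "positive_energy_rep \<pi>' h'" and "normalized_rep \<pi>' c'"
    and "c = c'" and "h = h'"
  shows "unitarily_equivalent \<pi> \<pi>'"
proof -
  note lin = projective_rep_linear[OF assms(3)] projective_rep_linear[OF assms(8)]
  obtain \<Omega> where \<Omega>: "highest_weight_vector \<pi> h \<Omega>"
    using exists_highest_weight_vector[OF assms(2-5)] .
  obtain \<Omega>' where \<Omega>': "highest_weight_vector \<pi>' h \<Omega>'"
    using exists_highest_weight_vector[OF assms(7-10)] assms(12) by blast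
  have "\<Omega> \<noteq> 0" "\<Omega>' \<noteq> 0"
    using \<Omega> \<Omega>' by (auto simp: highest_weight_vector_def)
  then have span: "cvec.span (range (\<lambda>w. word_op \<pi> w \<Omega>)) = UNIV"
      "cvec.span (range (\<lambda>w. word_op \<pi>' w \<Omega>')) = UNIV"
    using span_words assms by blast+
  have "cinner \<Omega> (word_op \<pi> w \<Omega>) = cinner \<Omega>' (word_op \<pi>' w \<Omega>')" for w
    using vacuum_expectation_unique[OF assms(2,3,5) \<Omega> assms(7,8) _ \<Omega>'] assms(10,11) by blast
  \<comment> \<open>Moving \<open>v\<close> across gives the expectation of the reversed adjoint of
    \<open>v\<close> followed by \<open>w\<close>.\<close>
  then have gram: "cinner (word_op \<pi> v \<Omega>) (word_op \<pi> w \<Omega>)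
      = cinner (word_op \<pi>' v \<Omega>') (word_op \<pi>' w \<Omega>')" for v w
    using cinner_word_op[OF assms(2)] cinner_word_op[OF assms(7)] by (metis word_op_append)
  obtain U where U: "clinear U" "bij U" "\<And>x y. cinner (U x) (U y) = cinner x y"
      and Uw: "\<And>w. U (word_op \<pi> w \<Omega>) = word_op \<pi>' w \<Omega>'"
    using exists_isometry_of_equal_gram[OF span gram] by blast
  interpret U: Vector_Spaces.linear scaleC scaleC U
    by (rule U(1))
  have basis: "U (\<pi> (basis_vector b) x) = \<pi>' (basis_vector b) (U x)" for b x
  proof -
    have "x \<in> cvec.span (range (\<lambda>w. word_op \<pi> w \<Omega>))"
      using span by simp
    then show ?thesis
    proof (induction rule: cvec.span_induct_alt)
      case base
      show ?case
        by (simp add: lin U.zero)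
    next
      case (step a v z)
      then obtain w where v: "v = word_op \<pi> w \<Omega>"
        by blast
      \<comment> \<open>A letter applied to a word gives the word \<open>b # w\<close>, on which
        \<open>U\<close> is already known.\<close>
      have "U (\<pi> (basis_vector b) v) = \<pi>' (basis_vector b) (U v)"
        using Uw[of "b # w"] Uw[of w] v by simp
      with step show ?case
        by (simp add: lin U.add U.scale)
    qed
  qed
  have "U (\<pi> A x) = \<pi>' A (U x)" for A x
    by (induction A rule: witt_induct) (simp_all add: lin U.add U.scale basis)
  with U show ?thesis
    unfolding unitarily_equivalent_def by blast
qed

end
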